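(* Let $(\alpha,\beta,t)$ be an admissible triple with $\alpha>0$ (see context), let $p_n,r_n,q_n$ ($n\in\mathbb{Z}$) be the associated coefficients and $P$ the associated doubly infinite stochastic tridiagonal matrix. Then the continued fractions $H$ and $H'$ satisfy $$H=H'=\frac{\alpha+t}{\alpha+\beta+2t+1}.$$ Therefore there exists only one value of the parameter $y_0$, namely $y_0=H$, for which one obtains a stochastic UL factorization $P=P_UP_L$, and the coefficients of the factors $P_U$ and $P_L$ are given, for all $n\in\mathbb{Z}$, by $$y_n=\frac{n+t+\alpha}{2n+2t+\alpha+\beta+1},\quad x_n=\frac{n+t+\beta+1}{2n+2t+\alpha+\beta+1},\quad s_n=\frac{n+t+\alpha+\beta}{2n+2t+\alpha+\beta},\quad t_n=\frac{n+t}{2n+2t+\alpha+\beta}.$$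
   Context: Admissible triples with $\alpha>0$: $0<\alpha<1$, $-1<\beta<0$, $t\in\mathbb{R}$, and one of the following holds: (A1) $\beta-\alpha+1>0$, $\alpha>-\beta$, and $t\in\bigcup_{n\in\mathbb{Z}}(n,n-\beta)\cup(n-\alpha,n-\alpha-\beta)$; (A2) $\beta-\alpha+1>0$, $\alpha<-\beta$, and $t\in\bigcup_{n\in\mathbb{Z}}(n-\alpha,n)\cup(n-\alpha-\beta,n-\beta)$; (B1) $\beta-\alpha+1<0$, $\alpha>-\beta$, and $t\in\bigcup_{n\in\mathbb{Z}}(n,n-\alpha+1)\cup(n-\beta,n-\alpha-\beta+1)$; (B2) $\beta-\alpha+1<0$, $\alpha<-\beta$, and $t\in\bigcup_{n\in\mathbb{Z}}(n-\beta-1,n)\cup(n-\alpha-\beta,n-\alpha+1)$. Coefficients: for $n\in\mathbb{Z}$, $$p_n=\frac{(n+t+\beta+1)(n+t+\alpha+\beta+1)}{(2n+2t+\alpha+\beta+1)(2n+2t+\alpha+\beta+2)},\qquad q_n=\frac{(n+t)(n+t+\alpha)}{(2n+2t+\alpha+\beta)(2n+2t+\alpha+\beta+1)},$$ $$r_n=\frac{(n+t+\beta+1)(n+t+1)}{(2n+2t+\alpha+\beta+1)(2n+2t+\alpha+\beta+2)}+\frac{(n+t+\alpha)(n+t+\alpha+\beta)}{(2n+2t+\alpha+\beta)(2n+2t+\alpha+\beta+1)}.$$ For admissible triples these are all positive and $p_n+r_n+q_n=1$. $P=(P_{i,j})_{i,j\in\mathbb{Z}}$ is the doubly infinite tridiagonal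 matrix with $P_{n,n+1}=p_n$, $P_{n,n}=r_n$, $P_{n,n-1}=q_n$ and all other entries $0$. Stochastic UL factorization: $P=P_UP_L$, where $P_U$ is doubly infinite upper bidiagonal with $(P_U)_{n,n}=y_n$, $(P_U)_{n,n+1}=x_n$ and $P_L$ is doubly infinite lower bidiagonal with $(P_L)_{n,n}=s_n$, $(P_L)_{n,n-1}=t_n$ (all other entries $0$), all entries are nonnegative, and $x_n+y_n=1$, $s_n+t_n=1$ for all $n\in\mathbb{Z}$. Equivalently $p_n=x_ns_{n+1}$, $r_n=x_nt_{n+1}+y_ns_n$, $q_n=y_nt_n$ for all $n\in\mathbb{Z}$. The sequences are determined recursively by the single free parameter $y_0$. (The sequence $(t_n)_{n\in\mathbb{Z}}$ is not to be confused with the real parameter $t$.) Continued fractions (values are limits of the convergents): $$H=1-\cfrac{p_0}{1-\cfrac{q_1}{1-\cfrac{p_1}{1-\cfrac{q_2}{1-\cdots}}}},\qquad H'=\cfrac{q_0}{1-\cfrac{p_{-1}}{1-\cfrac{q_{-1}}{1-\cfrac{p_{-2}}{1-\cdots}}}}.$$ *)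

theory Defs
  imports "HOL-Analysis.Analysis"
begin

definition admissible_pos :: "real \<Rightarrow> real \<Rightarrow> real \<Rightarrow> bool" where
  "admissible_pos \<alpha> \<beta> t \<longleftrightarrow>
     0 < \<alpha> \<and> \<alpha> < 1 \<and> -1 < \<beta> \<and> \<beta> < 0 \<and>
     ((\<beta> - \<alpha> + 1 > 0 \<and> \<alpha> > -\<beta> \<and>
         t \<in> (\<Union>n::int. {of_int n <..< of_int n - \<beta>} \<union>
                        {of_int n - \<alpha> <..< of_int n - \<alpha> - \<beta>})) \<or>
      (\<beta> - \<alpha> + 1 > 0 \<and> \<alpha> < -\<beta> \<and>
         t \<in> (\<Union>n::int. {of_int n - \<alpha> <..< of_int n} \<union>
                        {of_int n - \<alpha> - \<beta> <..< of_int n - \<beta>})) \<or>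
      (\<beta> - \<alpha> + 1 < 0 \<and> \<alpha> > -\<beta> \<and>
         t \<in> (\<Union>n::int. {of_int n <..< of_int n - \<alpha> + 1} \<union>
                        {of_int n - \<beta> <..< of_int n - \<alpha> - \<beta> + 1})) \<or>
      (\<beta> - \<alpha> + 1 < 0 \<and> \<alpha> < -\<beta> \<and>
         t \<in> (\<Union>n::int. {of_int n - \<beta> - 1 <..< of_int n} \<union>
                        {of_int n - \<alpha> - \<beta> <..< of_int n - \<alpha> + 1})))"

definition p_coeff :: "real \<Rightarrow> real \<Rightarrow> real \<Rightarrow> int \<Rightarrow> real" where
  "p_coeff \<alpha> \<beta> t n =
     ((of_int n + t + \<beta> + 1) * (of_int n + t + \<alpha> + \<beta> + 1)) /
     ((2 * of_int n + 2 * t + \<alpha> + \<beta> + 1) * (2 * of_int n + 2 * t + \<alpha> + \<beta> + 2))"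

definition q_coeff :: "real \<Rightarrow> real \<Rightarrow> real \<Rightarrow> int \<Rightarrow> real" where
  "q_coeff \<alpha> \<beta> t n =
     ((of_int n + t) * (of_int n + t + \<alpha>)) /
     ((2 * of_int n + 2 * t + \<alpha> + \<beta>) * (2 * of_int n + 2 * t + \<alpha> + \<beta> + 1))"

definition r_coeff :: "real \<Rightarrow> real \<Rightarrow> real \<Rightarrow> int \<Rightarrow> real" where
  "r_coeff \<alpha> \<beta> t n =
     ((of_int n + t + \<beta> + 1) * (of_int n + t + 1)) /
     ((2 * of_int n + 2 * t + \<alpha> + \<beta> + 1) * (2 * of_int n + 2 * t + \<alpha> + \<beta> + 2)) +
     ((of_int n + t + \<alpha>) * (of_int n + t + \<alpha> + \<beta>)) /
     ((2 * of_int n + 2 * t + \<alpha> + \<beta>) * (2 * of_int n + 2 * t + \<alpha> + \<beta> + 1))"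

type_synonym zmat = "int \<Rightarrow> int \<Rightarrow> real"

definition P_mat :: "real \<Rightarrow> real \<Rightarrow> real \<Rightarrow> zmat" where
  "P_mat \<alpha> \<beta> t i j =
     (if j = i + 1 then p_coeff \<alpha> \<beta> t i
      else if j = i then r_coeff \<alpha> \<beta> t i
      else if j = i - 1 then q_coeff \<alpha> \<beta> t i
      else 0)"

text \<open>For the bidiagonal factors below, the sum has only finitely many nonzero terms.\<close>

definition zmat_mult :: "zmat \<Rightarrow> zmat \<Rightarrow> zmat" where
  "zmat_mult A B i j = (\<Sum>\<^sub>\<infinity>k\<in>UNIV. A i k * B k j)"

definition upper_bidiag :: "(int \<Rightarrow> real) \<Rightarrow> (int \<Rightarrow> real) \<Rightarrow> zmat" where
  "upper_bidiag y x i j = (if j = i then y i else if j = i + 1 then x i else 0)"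

definition lower_bidiag :: "(int \<Rightarrow> real) \<Rightarrow> (int \<Rightarrow> real) \<Rightarrow> zmat" where
  "lower_bidiag s \<tau> i j = (if j = i then s i else if j = i - 1 then \<tau> i else 0)"

definition stochastic_UL ::
  "zmat \<Rightarrow> (int \<Rightarrow> real) \<Rightarrow> (int \<Rightarrow> real) \<Rightarrow> (int \<Rightarrow> real) \<Rightarrow> (int \<Rightarrow> real) \<Rightarrow> bool" where
  "stochastic_UL P y x s \<tau> \<longleftrightarrow>
     (\<forall>n. 0 \<le> y n \<and> 0 \<le> x n \<and> 0 \<le> s n \<and> 0 \<le> \<tau> n) \<and>
     (\<forall>n. x n + y n = 1 \<and> s n + \<tau> n = 1) \<and>
     P = zmat_mult (upper_bidiag y x) (lower_bidiag s \<tau>)"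

text \<open>
  The continued fraction b 0 + a 1 / (b 1 + a 2 / (b 2 + ...)); the value a 0 is not used.
  Its convergents are quotients of the numerators and denominators given by the
  fundamental (Wallis) recurrence.
\<close>

fun cf_num :: "(nat \<Rightarrow> real) \<Rightarrow> (nat \<Rightarrow> real) \<Rightarrow> nat \<Rightarrow> real" where
  "cf_num b a 0 = b 0"
| "cf_num b a (Suc 0) = b 1 * b 0 + a 1"
| "cf_num b a (Suc (Suc n)) =
     b (Suc (Suc n)) * cf_num b a (Suc n) + a (Suc (Suc n)) * cf_num b a n"

fun cf_den :: "(nat \<Rightarrow> real) \<Rightarrow> (nat \<Rightarrow> real) \<Rightarrow> nat \<Rightarrow> real" where
  "cf_den b a 0 = 1"
| "cf_den b a (Suc 0) = b 1"
| "cf_den b a (Suc (Suc n)) =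
     b (Suc (Suc n)) * cf_den b a (Suc n) + a (Suc (Suc n)) * cf_den b a n"

definition cf_convergent :: "(nat \<Rightarrow> real) \<Rightarrow> (nat \<Rightarrow> real) \<Rightarrow> nat \<Rightarrow> real" where
  "cf_convergent b a n = cf_num b a n / cf_den b a n"

text \<open>The condition on the denominators excludes convergents that are only defined
  through the convention x / 0 = 0.\<close>

definition cf_converges :: "(nat \<Rightarrow> real) \<Rightarrow> (nat \<Rightarrow> real) \<Rightarrow> bool" where
  "cf_converges b a \<longleftrightarrow>
     (\<forall>\<^sub>F n in sequentially. cf_den b a n \<noteq> 0) \<and> convergent (cf_convergent b a)"

definition cf_value :: "(nat \<Rightarrow> real) \<Rightarrow> (nat \<Rightarrow> real) \<Rightarrow> real" where
  "cf_value b a = lim (cf_convergent b a)"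

text \<open>The partial numerators of H are -p 0, -q 1, -p 1, -q 2, ..., and those of H'
  are q 0, -p (-1), -q (-1), -p (-2), ..., starting at index 1.\<close>

definition H_b :: "nat \<Rightarrow> real" where
  "H_b k = 1"

definition H_a :: "real \<Rightarrow> real \<Rightarrow> real \<Rightarrow> nat \<Rightarrow> real" where
  "H_a \<alpha> \<beta> t k =
     (if odd k then - p_coeff \<alpha> \<beta> t (int (k div 2)) else - q_coeff \<alpha> \<beta> t (int (k div 2)))"

definition H'_b :: "nat \<Rightarrow> real" where
  "H'_b k = (if k = 0 then 0 else 1)"

definition H'_a :: "real \<Rightarrow> real \<Rightarrow> real \<Rightarrow> nat \<Rightarrow> real" where
  "H'_a \<alpha> \<beta> t k =
     (if k = 1 then q_coeff \<alpha> \<beta> t 0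
      else if even k then - p_coeff \<alpha> \<beta> t (- int (k div 2))
      else - q_coeff \<alpha> \<beta> t (- int (k div 2)))"

definition cf_H :: "real \<Rightarrow> real \<Rightarrow> real \<Rightarrow> real" where
  "cf_H \<alpha> \<beta> t = cf_value H_b (H_a \<alpha> \<beta> t)"

definition cf_H' :: "real \<Rightarrow> real \<Rightarrow> real \<Rightarrow> real" where
  "cf_H' \<alpha> \<beta> t = cf_value H'_b (H'_a \<alpha> \<beta> t)"

end

theory Submission
  imports Defs
begin

text \<open>
  Both continued fractions are built from products that any stochastic UL factorization
  displays. Since $p_n = x_n s_{n+1}$ and $q_n = y_n t_n$ with $x_n = 1 - y_n$, $t_n = 1 - s_n$,
  the sequence $h = (y_0, s_1, y_1, s_2, \dots)$ turns the partial numerators of $H$ into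
  $-(1 - h_{k-1}) h_k$: they form a chain sequence with parameters $h$. In the same way
  the sequence $(x_0, t_0, x_{-1}, t_{-1}, \dots)$ gives the partial numerators of $1 - H'$.

  For such a continued fraction $1 - (1-h_0)h_1/(1 - (1-h_1)h_2/(1 - \cdots))$ the Wallis
  recurrence can be solved: the $n$-th convergent is
  \[ h_0 + \frac{1 - h_0}{\sum_{k \le n} \prod_{i=1}^{k} h_i/(1 - h_i)} \]
  (\<open>chain_cf_convergent\<close>). Two consequences carry the whole proof. Whatever the parameters in
  $(0,1)$ are, the convergents are at least $h_0$; applied to both chains of an arbitrary
  stochastic factorization this gives $H' \le y_0 \le H$. And if the series in the denominator
  diverges, the value is exactly $h_0$.

  For the factorization with the rational entries of the theorem, two consecutive factors
  $h_i/(1-h_i)$ multiply to a quotient of two quadratic polynomials in the index, of the form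
  $1 + (2\alpha-1)/m + O(m^{-2})$, on both sides. As $\alpha > 0$, Raabe's test shows that both series
  diverge (\<open>not_summable_quadratic_ratio\<close>), hence $H$ and $H'$ both equal the explicit $y_0$ and
  the interval $[H', H]$ that contains every possible $y_0$ is a point. Replacing
  $t$ by $t + n$ shifts all coefficients by $n$, so the same argument determines every $y_n$, and
  with it all the other entries.

  The intervals for $t$ enter only through signs: they guarantee that $n+t+\alpha$ and $n+t+\beta+1$ have
  the same sign for every integer $n$, and so do $n+t$ and $n+t+\alpha+\beta$
  (\<open>admissible_pos_factors_same_sign\<close>). Each denominator of the explicit entries is the sum of such
  a pair, so these entries lie in $(0,1)$.
\<close>

section \<open>Continued fractions of chain sequences\<close>

definition chain_weight :: "(nat \<Rightarrow> real) \<Rightarrow> nat \<Rightarrow> real" where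
  "chain_weight h n = (\<Prod>i=1..n. h i / (1 - h i))"

text \<open>The product $\prod_{i \le n} (1 - h_i)$ solves the second-order Wallis recurrence. Knowing one solution
  reduces the recurrence to first order, with an inhomogeneous term that is again a product.\<close>

lemma chain_cf_den_Suc:
  fixes h a :: "nat \<Rightarrow> real"
  assumes a: "\<And>k. a (Suc k) = - ((1 - h k) * h (Suc k))"
  shows "cf_den (\<lambda>_. 1) a (Suc n) = (1 - h (Suc n)) * cf_den (\<lambda>_. 1) a n + (\<Prod>i=1..Suc n. h i)"
proof (induction n)
  case 0
  show ?case by simp
next
  case (Suc n)
  let ?D = "cf_den (\<lambda>_. 1) a"
  have "?D (Suc (Suc n)) = ?D (Suc n) - h (Suc (Suc n)) * ((1 - h (Suc n)) * ?D n)"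
    by (simp add: a algebra_simps)
  also have "(1 - h (Suc n)) * ?D n = ?D (Suc n) - (\<Prod>i=1..Suc n. h i)"
    using Suc by simp
  finally show ?case by (simp add: algebra_simps)
qed

lemma chain_cf_den_eq:
  fixes h a :: "nat \<Rightarrow> real"
  assumes a: "\<And>k. a (Suc k) = - ((1 - h k) * h (Suc k))"
    and ne: "\<And>k. h k \<noteq> 1"
  shows "cf_den (\<lambda>_. 1) a n = (\<Prod>i=1..n. 1 - h i) * (\<Sum>k\<le>n. chain_weight h k)"
proof (induction n)
  case 0
  show ?case by (simp add: chain_weight_def)
next
  case (Suc n)
  have nz: "(\<Prod>i=1..Suc n. 1 - h i) \<noteq> 0"
    using ne by (auto simp del: prod.cl_ivl_Suc)
  have "(\<Prod>i=1..Suc n. h i) = (\<Prod>i=1..Suc n. 1 - h i) * chain_weight h (Suc n)"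
    unfolding chain_weight_def prod_dividef
    by (simp only: times_divide_eq_right nonzero_mult_div_cancel_left[OF nz])
  moreover have "(\<Prod>i=1..Suc n. 1 - h i) = (1 - h (Suc n)) * (\<Prod>i=1..n. 1 - h i)"
    by simp
  moreover have "(\<Sum>k\<le>Suc n. chain_weight h k) = (\<Sum>k\<le>n. chain_weight h k) + chain_weight h (Suc n)"
    by simp
  ultimately show ?case
    unfolding chain_cf_den_Suc[of a h, OF a] Suc by (simp only: distrib_left mult.assoc)
qed

text \<open>The difference of the numerators and $h_0$ times the denominators solves the Wallis recurrence
  again, with the initial values of the product $\prod_{i \le n} (1 - h_i)$.\<close>

lemma chain_cf_num_eq:
  fixes h a :: "nat \<Rightarrow> real"
  assumes a: "\<And>k. a (Suc k) = - ((1 - h k) * h (Suc k))"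
  shows "cf_num (\<lambda>_. 1) a n = h 0 * cf_den (\<lambda>_. 1) a n + (1 - h 0) * (\<Prod>i=1..n. 1 - h i)"
proof (induction n rule: less_induct)
  case (less n)
  consider "n = 0" | "n = Suc 0" | m where "n = Suc (Suc m)"
    by (metis not0_implies_Suc)
  then show ?case
  proof cases
    case (3 m)
    let ?D = "cf_den (\<lambda>_. 1) a" and ?N = "cf_num (\<lambda>_. 1) a" and ?e = "\<lambda>n. \<Prod>i=1..n. 1 - h i"
    let ?c = "(1 - h (Suc m)) * h (Suc (Suc m))"
    have "?N (Suc (Suc m)) = ?N (Suc m) - ?c * ?N m"
      by (simp add: a)
    also have "?N (Suc m) = h 0 * ?D (Suc m) + (1 - h 0) * ?e (Suc m)"
      using less 3 by blast
    also have "?N m = h 0 * ?D m + (1 - h 0) * ?e m"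
      using less 3 by (metis lessI less_SucI)
    also have "h 0 * ?D (Suc m) + (1 - h 0) * ?e (Suc m) - ?c * (h 0 * ?D m + (1 - h 0) * ?e m) =
        h 0 * (?D (Suc m) - ?c * ?D m) + (1 - h 0) * (?e (Suc m) - ?c * ?e m)"
      by (simp only: algebra_simps)
    also have "?D (Suc m) - ?c * ?D m = ?D (Suc (Suc m))"
      by (simp add: a)
    also have "?e (Suc m) - ?c * ?e m = ?e (Suc (Suc m))"
      by (simp add: algebra_simps)
    finally show ?thesis by (simp only: 3)
  qed (simp_all add: a algebra_simps)
qed

lemma chain_weight_pos:
  assumes "\<And>k. h (Suc k) > 0" "\<And>k. h k < 1"
  shows "chain_weight h n > 0"
  unfolding chain_weight_def
proof (rule prod_pos)
  fix i assume "i \<in> {1..n}"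
  then have "h i > 0" using assms(1)[of "i - 1"] by simp
  then show "h i / (1 - h i) > 0" using assms(2)[of i] by simp
qed

lemma chain_cf_convergent:
  fixes h a :: "nat \<Rightarrow> real"
  assumes a: "\<And>k. a (Suc k) = - ((1 - h k) * h (Suc k))"
    and pos: "\<And>k. h (Suc k) > 0" and lt1: "\<And>k. h k < 1"
  shows "cf_den (\<lambda>_. 1) a n > 0"
    and "cf_convergent (\<lambda>_. 1) a n = h 0 + (1 - h 0) / (\<Sum>k\<le>n. chain_weight h k)"
proof -
  have ne: "\<And>k. h k \<noteq> 1" using lt1 by (metis less_irrefl)
  have P: "(\<Prod>i=1..n. 1 - h i) > 0" using lt1 by (intro prod_pos) simp
  have S: "(\<Sum>k\<le>n. chain_weight h k) > 0"
    using chain_weight_pos[of h, OF pos lt1] by (intro sum_pos) auto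
  show "cf_den (\<lambda>_. 1) a n > 0"
    unfolding chain_cf_den_eq[of a h, OF a ne] using P S by simp
  have frac: "(c * (p * q) + d * p) / (p * q) = c + d / q" if "0 < p" "0 < q" for c d p q :: real
    using that by (simp add: field_simps)
  show "cf_convergent (\<lambda>_. 1) a n = h 0 + (1 - h 0) / (\<Sum>k\<le>n. chain_weight h k)"
    unfolding cf_convergent_def chain_cf_num_eq[of a h, OF a] chain_cf_den_eq[of a h, OF a ne]
    by (rule frac[OF P S])
qed

text \<open>This bound needs no information on convergence, which is why it applies to a factorization about
  which nothing else is known.\<close>

lemma chain_cf_convergent_ge:
  fixes h a :: "nat \<Rightarrow> real"
  assumes a: "\<And>k. a (Suc k) = - ((1 - h k) * h (Suc k))"
    and pos: "\<And>k. h (Suc k) > 0" and lt1: "\<And>k. h k < 1"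
  shows "h 0 \<le> cf_convergent (\<lambda>_. 1) a n"
  unfolding chain_cf_convergent(2)[of a h, OF a pos lt1]
  using lt1[of 0] chain_weight_pos[of h, OF pos lt1]
  by (simp add: sum_nonneg less_imp_le)

lemma filterlim_sum_at_top_if_not_summable:
  fixes f :: "nat \<Rightarrow> real"
  assumes nonneg: "\<And>n. f n \<ge> 0" and div: "\<not> summable f"
  shows "filterlim (\<lambda>n. \<Sum>k\<le>n. f k) at_top sequentially"
  unfolding filterlim_at_top
proof
  fix Z
  obtain N where N: "\<not> (\<Sum>k<N. f k) \<le> Z"
    using summableI_nonneg_bounded[of f Z] nonneg div by blast
  show "\<forall>\<^sub>F n in sequentially. Z \<le> (\<Sum>k\<le>n. f k)"
    using eventually_ge_at_top[of N]
  proof eventually_elim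
    case (elim n)
    have "(\<Sum>k<N. f k) \<le> (\<Sum>k\<le>n. f k)"
      using elim nonneg by (intro sum_mono2) auto
    then show ?case using N by linarith
  qed
qed

lemma chain_cf_convergent_tendsto:
  fixes h a :: "nat \<Rightarrow> real"
  assumes a: "\<And>k. a (Suc k) = - ((1 - h k) * h (Suc k))"
    and pos: "\<And>k. h (Suc k) > 0" and lt1: "\<And>k. h k < 1"
    and div: "\<not> summable (chain_weight h)"
  shows "cf_convergent (\<lambda>_. 1) a \<longlonglongrightarrow> h 0"
proof -
  have "filterlim (\<lambda>n. \<Sum>k\<le>n. chain_weight h k) at_top sequentially"
    using chain_weight_pos[of h, OF pos lt1] div
    by (intro filterlim_sum_at_top_if_not_summable) (auto simp: less_imp_le)
  then have "(\<lambda>n. h 0 + (1 - h 0) / (\<Sum>k\<le>n. chain_weight h k)) \<longlonglongrightarrow> h 0 + 0"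
    by (intro tendsto_add tendsto_const real_tendsto_divide_at_top[OF tendsto_const])
  moreover have "cf_convergent (\<lambda>_. 1) a = (\<lambda>n. h 0 + (1 - h 0) / (\<Sum>k\<le>n. chain_weight h k))"
    using chain_cf_convergent(2)[of a h, OF a pos lt1] by (rule ext)
  ultimately show ?thesis by simp
qed

section \<open>Divergence of the weights\<close>

text \<open>The quotients of consecutive terms are $1 + (c+d-a-b)/n + O(n^{-2})$, so $f$ behaves like the power
  $n^{c+d-a-b}$ and Raabe's test applies.\<close>

lemma not_summable_quadratic_ratio:
  fixes f :: "nat \<Rightarrow> real"
  assumes pos: "\<And>n. f n > 0"
    and ratio: "\<And>n. f (Suc n) / f n =
      ((real n + c) * (real n + d)) / ((real n + a) * (real n + b))"
    and gt: "c + d - a - b > -1"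
  shows "\<not> summable f"
proof (rule raabes_test_divergence)
  show "\<forall>\<^sub>F n in sequentially. f n > 0" by (simp add: pos)
  \<comment> \<open>Raabe's expression as a function of $1/n$, whose limit can be read off\<close>
  let ?g = "\<lambda>n. ((a + b - c - d) + (a * b - c * d) / real n) / ((1 + c / real n) * (1 + d / real n))"
  have "?g \<longlonglongrightarrow> ((a + b - c - d) + 0) / ((1 + 0) * (1 + 0))"
    by (intro tendsto_intros lim_const_over_n) auto
  moreover have "\<forall>\<^sub>F n in sequentially. ?g n = real n * (f n / f (Suc n) - 1)"
    using eventually_gt_at_top[of 0]
  proof eventually_elim
    case (elim n)
    have "f (Suc n) / f n \<noteq> 0" using pos[of n] pos[of "Suc n"] by simp
    then have nz: "real n + c \<noteq> 0" "real n + d \<noteq> 0"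
      unfolding ratio by auto
    have "f n / f (Suc n) = inverse (f (Suc n) / f n)" by simp
    also have "\<dots> = ((real n + a) * (real n + b)) / ((real n + c) * (real n + d))"
      unfolding ratio by simp
    finally have *: "f n / f (Suc n) = \<dots>" .
    have "1 + c / real n = (real n + c) / real n" "1 + d / real n = (real n + d) / real n"
      "(a + b - c - d) + (a * b - c * d) / real n = ((a + b - c - d) * real n + (a * b - c * d)) / real n"
      using elim by (simp_all add: field_simps)
    then show ?case unfolding * using nz elim by (simp add: divide_simps) (simp add: algebra_simps)
  qed
  ultimately have "(\<lambda>n. real n * (f n / f (Suc n) - 1)) \<longlonglongrightarrow> a + b - c - d"
    by (simp add: tendsto_cong)
  then have "(\<lambda>n. ereal (of_nat n * (f n / f (Suc n) - 1))) \<longlonglongrightarrow> ereal (a + b - c - d)"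
    by simp
  then have "limsup (\<lambda>n. ereal (of_nat n * (f n / f (Suc n) - 1))) = ereal (a + b - c - d)"
    by (intro lim_imp_Limsup) simp_all
  then show "limsup (\<lambda>n. ereal (of_nat n * (f n / f (Suc n) - 1))) < 1"
    using gt by (simp add: one_ereal_def)
qed

text \<open>The parameters of the chains alternate between two rational functions of the index, so only the
  even-indexed weights have a uniform quotient; their divergence is enough.\<close>

lemma not_summable_chain_weight:
  fixes h :: "nat \<Rightarrow> real"
  assumes pos: "\<And>k. h (Suc k) > 0" and lt1: "\<And>k. h k < 1"
    and ratio: "\<And>m. (h (2*m+1) / (1 - h (2*m+1))) * (h (2*m+2) / (1 - h (2*m+2))) =
      ((real m + c) * (real m + d)) / ((real m + a) * (real m + b))"
    and gt: "c + d - a - b > -1"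
  shows "\<not> summable (chain_weight h)"
proof
  assume "summable (chain_weight h)"
  moreover have "inj ((*) 2 :: nat \<Rightarrow> nat)" by (simp add: inj_on_def)
  ultimately have "summable (chain_weight h \<circ> (*) 2)"
    using chain_weight_pos[of h, OF pos lt1] by (intro summable_reindex) (auto simp: less_imp_le)
  moreover have "\<not> summable (\<lambda>m. chain_weight h (2 * m))"
  proof (rule not_summable_quadratic_ratio[OF _ _ gt])
    fix m
    show W: "chain_weight h (2 * m) > 0" by (rule chain_weight_pos[of h, OF pos lt1])
    have "chain_weight h (2 * Suc m) = chain_weight h (2 * m) *
        ((h (2*m+1) / (1 - h (2*m+1))) * (h (2*m+2) / (1 - h (2*m+2))))"
      by (simp add: chain_weight_def)
    then show "chain_weight h (2 * Suc m) / chain_weight h (2 * m) =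
        ((real m + c) * (real m + d)) / ((real m + a) * (real m + b))"
      unfolding ratio using W by simp
  qed
  ultimately show False by (simp add: comp_def)
qed

section \<open>The complementary continued fraction\<close>

text \<open>Flipping the sign of the first partial numerator and replacing the leading $1$ by $0$ sends the
  value $v$ to $1 - v$. This puts $H'$, which starts with $0$, into the form of a chain.\<close>

lemma cf_num_den_one_minus:
  fixes a a' b' :: "nat \<Rightarrow> real"
  assumes b': "b' 0 = 0" "\<And>k. b' (Suc k) = 1"
    and a': "a' (Suc 0) = - a (Suc 0)" "\<And>k. a' (Suc (Suc k)) = a (Suc (Suc k))"
  shows "cf_den b' a' n = cf_den (\<lambda>_. 1) a n"
    and "cf_num b' a' n = cf_den (\<lambda>_. 1) a n - cf_num (\<lambda>_. 1) a n"
proof -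
  have "cf_den b' a' n = cf_den (\<lambda>_. 1) a n \<and>
    cf_num b' a' n = cf_den (\<lambda>_. 1) a n - cf_num (\<lambda>_. 1) a n"
  proof (induction n rule: less_induct)
    case (less n)
    consider "n = 0" | "n = Suc 0" | m where "n = Suc (Suc m)"
      by (metis not0_implies_Suc)
    then show ?case
    proof cases
      case (3 m)
      have "cf_den b' a' k = cf_den (\<lambda>_. 1) a k"
        "cf_num b' a' k = cf_den (\<lambda>_. 1) a k - cf_num (\<lambda>_. 1) a k" if "k < n" for k
        using less that by auto
      from this[of m] this[of "Suc m"] show ?thesis
        unfolding 3 by (simp add: assms right_diff_distrib)
    qed (simp_all add: assms)
  qed
  then show "cf_den b' a' n = cf_den (\<lambda>_. 1) a n"
    and "cf_num b' a' n = cf_den (\<lambda>_. 1) a n - cf_num (\<lambda>_. 1) a n" by auto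
qed

section \<open>Bidiagonal factors\<close>

lemma zmat_mult_bidiag:
  "zmat_mult (upper_bidiag y x) (lower_bidiag s \<tau>) i j =
    y i * lower_bidiag s \<tau> i j + x i * lower_bidiag s \<tau> (i + 1) j"
proof -
  have "zmat_mult (upper_bidiag y x) (lower_bidiag s \<tau>) i j =
    infsum (\<lambda>k. upper_bidiag y x i k * lower_bidiag s \<tau> k j) {i, i + 1}"
    unfolding zmat_mult_def by (rule infsum_cong_neutral) (auto simp: upper_bidiag_def)
  then show ?thesis by (simp add: upper_bidiag_def)
qed

lemma P_mat_eq_UL_iff:
  "P_mat \<alpha> \<beta> t = zmat_mult (upper_bidiag y x) (lower_bidiag s \<tau>) \<longleftrightarrow>
    (\<forall>n. p_coeff \<alpha> \<beta> t n = x n * s (n + 1) \<and>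
         r_coeff \<alpha> \<beta> t n = x n * \<tau> (n + 1) + y n * s n \<and>
         q_coeff \<alpha> \<beta> t n = y n * \<tau> n)" (is "?L \<longleftrightarrow> ?R")
proof
  assume ?L
  then have e: "P_mat \<alpha> \<beta> t i j = y i * lower_bidiag s \<tau> i j + x i * lower_bidiag s \<tau> (i + 1) j" for i j
    by (simp add: zmat_mult_bidiag)
  show ?R
  proof
    fix n
    show "p_coeff \<alpha> \<beta> t n = x n * s (n + 1) \<and>
         r_coeff \<alpha> \<beta> t n = x n * \<tau> (n + 1) + y n * s n \<and>
         q_coeff \<alpha> \<beta> t n = y n * \<tau> n"
      using e[of n "n + 1"] e[of n n] e[of n "n - 1"]
      by (simp add: P_mat_def lower_bidiag_def)
  qed
next
  assume R: ?R
  show ?L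
    by (intro ext) (use R in \<open>auto simp: zmat_mult_bidiag P_mat_def lower_bidiag_def\<close>)
qed


section \<open>Signs of the linear factors\<close>

text \<open>The zeros $-a$ and $-b$ lie strictly between the consecutive integers $m - 1$ and $m$, so no
  integer separates them.\<close>

lemma same_sign_if_zeros_in_unit_interval:
  fixes a b :: real and m n :: int
  assumes "of_int m + a > 0" "of_int m + b > 0" "of_int m + a < 1" "of_int m + b < 1"
  shows "(of_int n + a) * (of_int n + b) > 0"
proof (cases "n \<ge> m")
  case True
  then have "real_of_int n \<ge> of_int m" by simp
  then show ?thesis using assms by (intro mult_pos_pos) linarith+
next
  case False
  then have "real_of_int (n + 1) \<le> of_int m" by (subst of_int_le_iff) simp
  then have "real_of_int n + 1 \<le> of_int m" by (simp only: of_int_add of_int_1)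
  then show ?thesis using assms by (intro mult_neg_neg) linarith+
qed

definition factors_same_sign :: "real \<Rightarrow> real \<Rightarrow> real \<Rightarrow> bool" where
  "factors_same_sign \<alpha> \<beta> t \<longleftrightarrow>
    (\<forall>n::int. 0 < (of_int n + t + \<alpha>) * (of_int n + t + \<beta> + 1) \<and>
              0 < (of_int n + t) * (of_int n + t + \<alpha> + \<beta>))"

lemma factors_same_signI:
  fixes m k :: int
  assumes "of_int m + (t + \<alpha>) > 0" "of_int m + (t + \<beta> + 1) > 0"
    "of_int m + (t + \<alpha>) < 1" "of_int m + (t + \<beta> + 1) < 1"
    and "of_int k + t > 0" "of_int k + (t + \<alpha> + \<beta>) > 0"
    "of_int k + t < 1" "of_int k + (t + \<alpha> + \<beta>) < 1"
  shows "factors_same_sign \<alpha> \<beta> t"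
  using same_sign_if_zeros_in_unit_interval[OF assms(1-4)]
    same_sign_if_zeros_in_unit_interval[OF assms(5-8)]
  by (simp add: factors_same_sign_def add.assoc)

text \<open>In each of the eight families of intervals it suffices to find, for each pair of linear factors,
  the integer at which both become positive.\<close>

lemma admissible_pos_factors_same_sign:
  assumes "admissible_pos \<alpha> \<beta> t"
  shows "factors_same_sign \<alpha> \<beta> t"
proof -
  have rng: "0 < \<alpha>" "\<alpha> < 1" "-1 < \<beta>" "\<beta> < 0"
    using assms by (auto simp: admissible_pos_def)
  consider
      (A1a) n :: int where "\<beta> - \<alpha> + 1 > 0" "\<alpha> > -\<beta>" "of_int n < t" "t < of_int n - \<beta>"
    | (A1b) n :: int where "\<beta> - \<alpha> + 1 > 0" "\<alpha> > -\<beta>" "of_int n - \<alpha> < t" "t < of_int n - \<alpha> - \<beta>"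
    | (A2a) n :: int where "\<beta> - \<alpha> + 1 > 0" "\<alpha> < -\<beta>" "of_int n - \<alpha> < t" "t < of_int n"
    | (A2b) n :: int where "\<beta> - \<alpha> + 1 > 0" "\<alpha> < -\<beta>" "of_int n - \<alpha> - \<beta> < t" "t < of_int n - \<beta>"
    | (B1a) n :: int where "\<beta> - \<alpha> + 1 < 0" "\<alpha> > -\<beta>" "of_int n < t" "t < of_int n - \<alpha> + 1"
    | (B1b) n :: int where "\<beta> - \<alpha> + 1 < 0" "\<alpha> > -\<beta>" "of_int n - \<beta> < t" "t < of_int n - \<alpha> - \<beta> + 1"
    | (B2a) n :: int where "\<beta> - \<alpha> + 1 < 0" "\<alpha> < -\<beta>" "of_int n - \<beta> - 1 < t" "t < of_int n"
    | (B2b) n :: int where "\<beta> - \<alpha> + 1 < 0" "\<alpha> < -\<beta>" "of_int n - \<alpha> - \<beta> < t" "t < of_int n - \<alpha> + 1"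
    using assms unfolding admissible_pos_def by auto
  then show ?thesis
  proof cases
    case (A1a n)
    show ?thesis
      by (rule factors_same_signI[of "-n" _ _ _ "-n"]) (use A1a rng in \<open>simp_all\<close>)
  next
    case (A1b n)
    show ?thesis
      by (rule factors_same_signI[of "-n" _ _ _ "1-n"]) (use A1b rng in \<open>simp_all\<close>)
  next
    case (A2a n)
    show ?thesis
      by (rule factors_same_signI[of "-n" _ _ _ "1-n"]) (use A2a rng in \<open>simp_all\<close>)
  next
    case (A2b n)
    show ?thesis
      by (rule factors_same_signI[of "-n" _ _ _ "-n"]) (use A2b rng in \<open>simp_all\<close>)
  next
    case (B1a n)
    show ?thesis
      by (rule factors_same_signI[of "-n" _ _ _ "-n"]) (use B1a rng in \<open>simp_all\<close>)
  next
    case (B1b n)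
    show ?thesis
      by (rule factors_same_signI[of "-n-1" _ _ _ "-n"]) (use B1b rng in \<open>simp_all\<close>)
  next
    case (B2a n)
    show ?thesis
      by (rule factors_same_signI[of "-n" _ _ _ "1-n"]) (use B2a rng in \<open>simp_all\<close>)
  next
    case (B2b n)
    show ?thesis
      by (rule factors_same_signI[of "-n" _ _ _ "-n"]) (use B2b rng in \<open>simp_all\<close>)
  qed
qed

section \<open>The two chains of a stochastic factorization\<close>

definition right_chain :: "(int \<Rightarrow> real) \<Rightarrow> (int \<Rightarrow> real) \<Rightarrow> nat \<Rightarrow> real" where
  "right_chain y s k = (if even k then y (int (k div 2)) else s (int (k div 2) + 1))"

definition left_chain :: "(int \<Rightarrow> real) \<Rightarrow> (int \<Rightarrow> real) \<Rightarrow> nat \<Rightarrow> real" where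
  "left_chain x \<tau> k = (if even k then x (- int (k div 2)) else \<tau> (- int (k div 2)))"

text \<open>These are the partial numerators of $1 - H'$ read as a chain: they differ from those of $H'$ only in
  the sign of the first one.\<close>

definition left_a :: "real \<Rightarrow> real \<Rightarrow> real \<Rightarrow> nat \<Rightarrow> real" where
  "left_a \<alpha> \<beta> t k =
    (if odd k then - q_coeff \<alpha> \<beta> t (- int (k div 2)) else - p_coeff \<alpha> \<beta> t (- int (k div 2)))"

text \<open>The part of a stochastic factorization that the chains see: the two off-diagonals of the product and
  the row sums. The bounds are strict because $p_n$ and $q_n$ are positive in the cases of interest.\<close>

locale UL_entries =
  fixes \<alpha> \<beta> t :: real and y x s \<tau> :: "int \<Rightarrow> real"
  assumes x_eq: "x n = 1 - y n" and tau_eq: "\<tau> n = 1 - s n"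
    and p_eq: "p_coeff \<alpha> \<beta> t n = x n * s (n + 1)"
    and q_eq: "q_coeff \<alpha> \<beta> t n = y n * \<tau> n"
    and y_pos: "0 < y n" and y_lt1: "y n < 1" and s_pos: "0 < s n" and s_lt1: "s n < 1"
begin

abbreviation "rh \<equiv> right_chain y s"
abbreviation "lh \<equiv> left_chain x \<tau>"

lemma right_chain_props:
  "H_a \<alpha> \<beta> t (Suc k) = - ((1 - rh k) * rh (Suc k))" "0 < rh k" "rh k < 1"
proof -
  show "H_a \<alpha> \<beta> t (Suc k) = - ((1 - rh k) * rh (Suc k))"
    by (cases "even k")
      (auto elim!: evenE oddE simp: H_a_def right_chain_def p_eq q_eq x_eq tau_eq add.commute)
  show "0 < rh k" "rh k < 1"
    by (auto simp: right_chain_def y_pos s_pos y_lt1 s_lt1)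
qed

lemma left_chain_props:
  "left_a \<alpha> \<beta> t (Suc k) = - ((1 - lh k) * lh (Suc k))" "0 < lh k" "lh k < 1"
proof -
  show "left_a \<alpha> \<beta> t (Suc k) = - ((1 - lh k) * lh (Suc k))"
    by (cases "even k")
      (auto elim!: evenE oddE simp: left_a_def left_chain_def p_eq q_eq x_eq tau_eq)
  show "0 < lh k" "lh k < 1"
    by (auto simp: left_chain_def x_eq tau_eq y_pos s_pos y_lt1 s_lt1)
qed

lemma H_b_eq: "H_b = (\<lambda>_. 1)"
  by (simp add: H_b_def fun_eq_iff)

lemma H_den_pos: "cf_den H_b (H_a \<alpha> \<beta> t) n > 0"
  unfolding H_b_eq by (rule chain_cf_convergent(1)[of _ rh]) (rule right_chain_props)+

lemma y0_le_H_convergent: "y 0 \<le> cf_convergent H_b (H_a \<alpha> \<beta> t) n"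
proof -
  have "rh 0 \<le> cf_convergent (\<lambda>_. 1) (H_a \<alpha> \<beta> t) n"
    by (rule chain_cf_convergent_ge) (rule right_chain_props)+
  then show ?thesis by (simp add: H_b_eq right_chain_def)
qed

lemma H_tendsto:
  assumes "\<not> summable (chain_weight rh)"
  shows "cf_convergent H_b (H_a \<alpha> \<beta> t) \<longlonglongrightarrow> y 0"
proof -
  have "cf_convergent (\<lambda>_. 1) (H_a \<alpha> \<beta> t) \<longlonglongrightarrow> rh 0"
    by (rule chain_cf_convergent_tendsto) (rule right_chain_props assms)+
  then show ?thesis by (simp add: H_b_eq right_chain_def)
qed

lemma H'_left:
  "cf_den H'_b (H'_a \<alpha> \<beta> t) n > 0"
  "cf_convergent H'_b (H'_a \<alpha> \<beta> t) n = 1 - cf_convergent (\<lambda>_. 1) (left_a \<alpha> \<beta> t) n"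
proof -
  have pos: "cf_den (\<lambda>_. 1) (left_a \<alpha> \<beta> t) n > 0"
    by (rule chain_cf_convergent(1)[of _ lh]) (rule left_chain_props)+
  have *: "cf_den H'_b (H'_a \<alpha> \<beta> t) n = cf_den (\<lambda>_. 1) (left_a \<alpha> \<beta> t) n"
    "cf_num H'_b (H'_a \<alpha> \<beta> t) n = cf_den (\<lambda>_. 1) (left_a \<alpha> \<beta> t) n - cf_num (\<lambda>_. 1) (left_a \<alpha> \<beta> t) n"
    by (rule cf_num_den_one_minus; simp add: H'_b_def H'_a_def left_a_def)+
  show "cf_den H'_b (H'_a \<alpha> \<beta> t) n > 0" using pos * by simp
  show "cf_convergent H'_b (H'_a \<alpha> \<beta> t) n = 1 - cf_convergent (\<lambda>_. 1) (left_a \<alpha> \<beta> t) n"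
    using pos unfolding cf_convergent_def * by (simp add: diff_divide_distrib)
qed

lemma H'_convergent_le_y0: "cf_convergent H'_b (H'_a \<alpha> \<beta> t) n \<le> y 0"
proof -
  have "lh 0 \<le> cf_convergent (\<lambda>_. 1) (left_a \<alpha> \<beta> t) n"
    by (rule chain_cf_convergent_ge) (rule left_chain_props)+
  then show ?thesis by (simp add: H'_left left_chain_def x_eq)
qed

lemma H'_tendsto:
  assumes "\<not> summable (chain_weight lh)"
  shows "cf_convergent H'_b (H'_a \<alpha> \<beta> t) \<longlonglongrightarrow> y 0"
proof -
  have "cf_convergent (\<lambda>_. 1) (left_a \<alpha> \<beta> t) \<longlonglongrightarrow> lh 0"
    by (rule chain_cf_convergent_tendsto) (rule left_chain_props assms)+
  then have "(\<lambda>n. 1 - cf_convergent (\<lambda>_. 1) (left_a \<alpha> \<beta> t) n) \<longlonglongrightarrow> 1 - lh 0"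
    by (intro tendsto_intros)
  moreover have "cf_convergent H'_b (H'_a \<alpha> \<beta> t) = (\<lambda>n. 1 - cf_convergent (\<lambda>_. 1) (left_a \<alpha> \<beta> t) n)"
    by (simp add: fun_eq_iff H'_left)
  ultimately show ?thesis by (simp add: left_chain_def x_eq)
qed

lemma UL_entries_shift:
  "UL_entries \<alpha> \<beta> (t + of_int m) (\<lambda>n. y (n + m)) (\<lambda>n. x (n + m)) (\<lambda>n. s (n + m)) (\<lambda>n. \<tau> (n + m))"
proof
  fix n
  have "p_coeff \<alpha> \<beta> (t + of_int m) n = p_coeff \<alpha> \<beta> t (n + m)"
    by (simp add: p_coeff_def algebra_simps)
  then show "p_coeff \<alpha> \<beta> (t + of_int m) n = x (n + m) * s (n + 1 + m)"
    by (simp add: p_eq ac_simps)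
  have "q_coeff \<alpha> \<beta> (t + of_int m) n = q_coeff \<alpha> \<beta> t (n + m)"
    by (simp add: q_coeff_def algebra_simps)
  then show "q_coeff \<alpha> \<beta> (t + of_int m) n = y (n + m) * \<tau> (n + m)"
    by (simp add: q_eq)
qed (simp_all add: x_eq tau_eq y_pos y_lt1 s_pos s_lt1)

end

section \<open>The explicit factorization\<close>

definition UL_y :: "real \<Rightarrow> real \<Rightarrow> real \<Rightarrow> int \<Rightarrow> real" where
  "UL_y \<alpha> \<beta> t n = (of_int n + t + \<alpha>) / (2 * of_int n + 2 * t + \<alpha> + \<beta> + 1)"
definition UL_x :: "real \<Rightarrow> real \<Rightarrow> real \<Rightarrow> int \<Rightarrow> real" where
  "UL_x \<alpha> \<beta> t n = (of_int n + t + \<beta> + 1) / (2 * of_int n + 2 * t + \<alpha> + \<beta> + 1)"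
definition UL_s :: "real \<Rightarrow> real \<Rightarrow> real \<Rightarrow> int \<Rightarrow> real" where
  "UL_s \<alpha> \<beta> t n = (of_int n + t + \<alpha> + \<beta>) / (2 * of_int n + 2 * t + \<alpha> + \<beta>)"
definition UL_t :: "real \<Rightarrow> real \<Rightarrow> real \<Rightarrow> int \<Rightarrow> real" where
  "UL_t \<alpha> \<beta> t n = (of_int n + t) / (2 * of_int n + 2 * t + \<alpha> + \<beta>)"

lemma same_sign_fraction:
  fixes u v w :: real
  assumes "0 < u * v" and "w = u + v"
  shows "0 < u / w" "0 < v / w" "u / w + v / w = 1"
    "u / w / (1 - u / w) = u / v" "v / w / (1 - v / w) = v / u"
proof -
  have nz: "u \<noteq> 0" "v \<noteq> 0" "u + v \<noteq> 0"
    using assms(1) by (auto simp: zero_less_mult_iff)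
  show "0 < u / w" "0 < v / w"
    using assms by (auto simp: zero_less_mult_iff zero_less_divide_iff)
  show sum: "u / w + v / w = 1" using nz by (simp add: assms(2) add_divide_distrib[symmetric])
  have compl: "1 - u / w = v / w" "1 - v / w = u / w" using sum by linarith+
  have "w \<noteq> 0" using nz assms(2) by simp
  then show "u / w / (1 - u / w) = u / v" "v / w / (1 - v / w) = v / u"
    unfolding compl by simp_all
qed

context
  fixes \<alpha> \<beta> t :: real
  assumes ns: "factors_same_sign \<alpha> \<beta> t"
begin

lemma UL_yx:
  "0 < UL_y \<alpha> \<beta> t n" "0 < UL_x \<alpha> \<beta> t n" "UL_y \<alpha> \<beta> t n + UL_x \<alpha> \<beta> t n = 1"
  "UL_y \<alpha> \<beta> t n / (1 - UL_y \<alpha> \<beta> t n) = (of_int n + t + \<alpha>) / (of_int n + t + \<beta> + 1)"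
  "UL_x \<alpha> \<beta> t n / (1 - UL_x \<alpha> \<beta> t n) = (of_int n + t + \<beta> + 1) / (of_int n + t + \<alpha>)"
proof -
  have "0 < (of_int n + t + \<alpha>) * (of_int n + t + \<beta> + 1)"
    using ns by (simp only: factors_same_sign_def)
  moreover have "2 * of_int n + 2 * t + \<alpha> + \<beta> + 1 = (of_int n + t + \<alpha>) + (of_int n + t + \<beta> + 1)"
    by simp
  ultimately show "0 < UL_y \<alpha> \<beta> t n" "0 < UL_x \<alpha> \<beta> t n" "UL_y \<alpha> \<beta> t n + UL_x \<alpha> \<beta> t n = 1"
    "UL_y \<alpha> \<beta> t n / (1 - UL_y \<alpha> \<beta> t n) = (of_int n + t + \<alpha>) / (of_int n + t + \<beta> + 1)"
    "UL_x \<alpha> \<beta> t n / (1 - UL_x \<alpha> \<beta> t n) = (of_int n + t + \<beta> + 1) / (of_int n + t + \<alpha>)"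
    unfolding UL_y_def UL_x_def by (rule same_sign_fraction)+
qed

lemma UL_ts:
  "0 < UL_t \<alpha> \<beta> t n" "0 < UL_s \<alpha> \<beta> t n" "UL_t \<alpha> \<beta> t n + UL_s \<alpha> \<beta> t n = 1"
  "UL_t \<alpha> \<beta> t n / (1 - UL_t \<alpha> \<beta> t n) = (of_int n + t) / (of_int n + t + \<alpha> + \<beta>)"
  "UL_s \<alpha> \<beta> t n / (1 - UL_s \<alpha> \<beta> t n) = (of_int n + t + \<alpha> + \<beta>) / (of_int n + t)"
proof -
  have "0 < (of_int n + t) * (of_int n + t + \<alpha> + \<beta>)"
    using ns by (simp only: factors_same_sign_def)
  moreover have "2 * of_int n + 2 * t + \<alpha> + \<beta> = (of_int n + t) + (of_int n + t + \<alpha> + \<beta>)"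
    by simp
  ultimately show "0 < UL_t \<alpha> \<beta> t n" "0 < UL_s \<alpha> \<beta> t n" "UL_t \<alpha> \<beta> t n + UL_s \<alpha> \<beta> t n = 1"
    "UL_t \<alpha> \<beta> t n / (1 - UL_t \<alpha> \<beta> t n) = (of_int n + t) / (of_int n + t + \<alpha> + \<beta>)"
    "UL_s \<alpha> \<beta> t n / (1 - UL_s \<alpha> \<beta> t n) = (of_int n + t + \<alpha> + \<beta>) / (of_int n + t)"
    unfolding UL_t_def UL_s_def by (rule same_sign_fraction)+
qed

lemma UL_product:
  "p_coeff \<alpha> \<beta> t n = UL_x \<alpha> \<beta> t n * UL_s \<alpha> \<beta> t (n + 1)"
  "q_coeff \<alpha> \<beta> t n = UL_y \<alpha> \<beta> t n * UL_t \<alpha> \<beta> t n"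
  "r_coeff \<alpha> \<beta> t n = UL_x \<alpha> \<beta> t n * UL_t \<alpha> \<beta> t (n + 1) + UL_y \<alpha> \<beta> t n * UL_s \<alpha> \<beta> t n"
  by (simp_all add: p_coeff_def q_coeff_def r_coeff_def UL_y_def UL_x_def UL_s_def UL_t_def ac_simps)

lemma UL_entries_explicit:
  "UL_entries \<alpha> \<beta> t (UL_y \<alpha> \<beta> t) (UL_x \<alpha> \<beta> t) (UL_s \<alpha> \<beta> t) (UL_t \<alpha> \<beta> t)"
proof
  fix n
  show "UL_x \<alpha> \<beta> t n = 1 - UL_y \<alpha> \<beta> t n" "UL_y \<alpha> \<beta> t n < 1"
    using UL_yx[of n] by linarith+
  show "UL_t \<alpha> \<beta> t n = 1 - UL_s \<alpha> \<beta> t n" "UL_s \<alpha> \<beta> t n < 1"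
    using UL_ts[of n] by linarith+
qed (rule UL_yx UL_ts UL_product)+

interpretation explicit: UL_entries \<alpha> \<beta> t "UL_y \<alpha> \<beta> t" "UL_x \<alpha> \<beta> t" "UL_s \<alpha> \<beta> t" "UL_t \<alpha> \<beta> t"
  by (rule UL_entries_explicit)

text \<open>On both sides the quadratic quotients have $c + d - a - b = 2\alpha - 1$, which exceeds $-1$ exactly
  because $\alpha > 0$.\<close>

lemma cf_limits:
  assumes "0 < \<alpha>"
  shows "cf_convergent H_b (H_a \<alpha> \<beta> t) \<longlonglongrightarrow> UL_y \<alpha> \<beta> t 0"
    and "cf_convergent H'_b (H'_a \<alpha> \<beta> t) \<longlonglongrightarrow> UL_y \<alpha> \<beta> t 0"
proof -
  let ?r = "right_chain (UL_y \<alpha> \<beta> t) (UL_s \<alpha> \<beta> t)"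
  let ?l = "left_chain (UL_x \<alpha> \<beta> t) (UL_t \<alpha> \<beta> t)"
  have "\<not> summable (chain_weight ?r)"
  proof (rule not_summable_chain_weight)
    fix m
    have "?r (2*m+1) = UL_s \<alpha> \<beta> t (int m + 1)" "?r (2*m+2) = UL_y \<alpha> \<beta> t (int m + 1)"
      by (simp_all add: right_chain_def add.commute)
    then show "?r (2*m+1) / (1 - ?r (2*m+1)) * (?r (2*m+2) / (1 - ?r (2*m+2))) =
        ((real m + (1 + t + \<alpha> + \<beta>)) * (real m + (1 + t + \<alpha>))) /
        ((real m + (1 + t)) * (real m + (2 + t + \<beta>)))"
      by (simp only: UL_yx UL_ts) (simp add: ac_simps)
  qed (use assms in \<open>auto intro: explicit.right_chain_props\<close>)
  then show "cf_convergent H_b (H_a \<alpha> \<beta> t) \<longlonglongrightarrow> UL_y \<alpha> \<beta> t 0"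
    by (rule explicit.H_tendsto)
  have "\<not> summable (chain_weight ?l)"
  proof (rule not_summable_chain_weight)
    fix m
    have "?l (2*m+1) = UL_t \<alpha> \<beta> t (- int m)" "?l (2*m+2) = UL_x \<alpha> \<beta> t (- 1 - int m)"
      by (simp_all add: left_chain_def)
    then have "?l (2*m+1) / (1 - ?l (2*m+1)) * (?l (2*m+2) / (1 - ?l (2*m+2))) =
        ((t - real m) / (t + \<alpha> + \<beta> - real m)) * ((t + \<beta> - real m) / (t + \<alpha> - 1 - real m))"
      by (simp only: UL_yx UL_ts) (simp add: algebra_simps)
    also have "(t - real m) / (t + \<alpha> + \<beta> - real m) = (real m + - t) / (real m + - (t + \<alpha> + \<beta>))"
      using minus_divide_divide[of "real m + - t" "real m + - (t + \<alpha> + \<beta>)"] by (simp add: algebra_simps)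
    also have "(t + \<beta> - real m) / (t + \<alpha> - 1 - real m) = (real m + - (t + \<beta>)) / (real m + (1 - t - \<alpha>))"
      using minus_divide_divide[of "real m + - (t + \<beta>)" "real m + (1 - t - \<alpha>)"] by (simp add: algebra_simps)
    finally show "?l (2*m+1) / (1 - ?l (2*m+1)) * (?l (2*m+2) / (1 - ?l (2*m+2))) =
        ((real m + - t) * (real m + - (t + \<beta>))) /
        ((real m + - (t + \<alpha> + \<beta>)) * (real m + (1 - t - \<alpha>)))"
      by simp
  qed (use assms in \<open>auto intro: explicit.left_chain_props\<close>)
  then show "cf_convergent H'_b (H'_a \<alpha> \<beta> t) \<longlonglongrightarrow> UL_y \<alpha> \<beta> t 0"
    by (rule explicit.H'_tendsto)
qed

lemma cf_converges_H:
  assumes "0 < \<alpha>"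
  shows "cf_converges H_b (H_a \<alpha> \<beta> t)" "cf_converges H'_b (H'_a \<alpha> \<beta> t)"
    "cf_H \<alpha> \<beta> t = UL_y \<alpha> \<beta> t 0" "cf_H' \<alpha> \<beta> t = UL_y \<alpha> \<beta> t 0"
proof -
  have "cf_den H_b (H_a \<alpha> \<beta> t) n \<noteq> 0" "cf_den H'_b (H'_a \<alpha> \<beta> t) n \<noteq> 0" for n
    using explicit.H_den_pos[of n] explicit.H'_left(1)[of n] by simp_all
  then show "cf_converges H_b (H_a \<alpha> \<beta> t)" "cf_converges H'_b (H'_a \<alpha> \<beta> t)"
    using cf_limits[OF assms] by (auto simp: cf_converges_def convergent_def)
  show "cf_H \<alpha> \<beta> t = UL_y \<alpha> \<beta> t 0" "cf_H' \<alpha> \<beta> t = UL_y \<alpha> \<beta> t 0"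
    unfolding cf_H_def cf_H'_def cf_value_def using cf_limits[OF assms] by (simp_all add: limI)
qed

lemma stochastic_UL_explicit:
  "stochastic_UL (P_mat \<alpha> \<beta> t) (UL_y \<alpha> \<beta> t) (UL_x \<alpha> \<beta> t) (UL_s \<alpha> \<beta> t) (UL_t \<alpha> \<beta> t)"
  unfolding stochastic_UL_def P_mat_eq_UL_iff
  using UL_yx UL_ts UL_product by (simp add: less_imp_le add.commute)

text \<open>
  The explicit factorization shows that all $p_n$ and $q_n$ are positive, and every entry of any other
  factorization is a factor of one of these.\<close>

lemma stochastic_UL_entries:
  assumes "stochastic_UL (P_mat \<alpha> \<beta> t) y x s \<tau>"
  shows "UL_entries \<alpha> \<beta> t y x s \<tau>"
proof -
  have nonneg: "0 \<le> y n" "0 \<le> x n" "0 \<le> s n" "0 \<le> \<tau> n"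
    and sums: "x n + y n = 1" "s n + \<tau> n = 1"
    and p: "p_coeff \<alpha> \<beta> t n = x n * s (n + 1)" and q: "q_coeff \<alpha> \<beta> t n = y n * \<tau> n" for n
    using assms by (simp_all add: stochastic_UL_def P_mat_eq_UL_iff)
  have "0 < x n * s (n + 1)" "0 < y n * \<tau> n" for n
    using UL_yx(1,2)[of n] UL_ts(1)[of n] UL_ts(2)[of "n + 1"] UL_product(1,2)[of n] p[of n] q[of n]
    by (metis mult_pos_pos)+
  then have "x n \<noteq> 0" "s (n + 1) \<noteq> 0" "y n \<noteq> 0" "\<tau> n \<noteq> 0" for n
    by (metis less_irrefl mult_zero_left mult_zero_right)+
  from this this(2)[of "n - 1" for n] nonneg have pos: "0 < x n" "0 < s n" "0 < y n" "0 < \<tau> n" for n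
    by (simp_all add: less_le)
  show ?thesis
  proof
    fix n
    show "x n = 1 - y n" "\<tau> n = 1 - s n" "y n < 1" "s n < 1"
      using sums[of n] pos[of n] by linarith+
  qed (rule pos p q)+
qed

end

lemma factors_same_sign_shift: "factors_same_sign \<alpha> \<beta> t \<Longrightarrow> factors_same_sign \<alpha> \<beta> (t + of_int m)"
  unfolding factors_same_sign_def
proof
  fix n :: int
  assume "\<forall>n::int. 0 < (of_int n + t + \<alpha>) * (of_int n + t + \<beta> + 1) \<and>
              0 < (of_int n + t) * (of_int n + t + \<alpha> + \<beta>)"
  from this[THEN spec, of "n + m"]
  show "0 < (of_int n + (t + of_int m) + \<alpha>) * (of_int n + (t + of_int m) + \<beta> + 1) \<and>
              0 < (of_int n + (t + of_int m)) * (of_int n + (t + of_int m) + \<alpha> + \<beta>)"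
    by (simp add: ac_simps)
qed

section \<open>Uniqueness\<close>

text \<open>Every possible $y_0$ is squeezed between the convergents of $H'$ and those of $H$, and by
  \<open>cf_limits\<close> these have the same limit.\<close>

lemma UL_entries_y0_unique:
  assumes "factors_same_sign \<alpha> \<beta> t" "0 < \<alpha>" "UL_entries \<alpha> \<beta> t y x s \<tau>"
  shows "y 0 = UL_y \<alpha> \<beta> t 0"
proof (rule antisym)
  show "y 0 \<le> UL_y \<alpha> \<beta> t 0"
    using cf_limits(1)[OF assms(1,2)] UL_entries.y0_le_H_convergent[OF assms(3)]
    by (intro LIMSEQ_le_const) auto
  show "UL_y \<alpha> \<beta> t 0 \<le> y 0"
    using cf_limits(2)[OF assms(1,2)] UL_entries.H'_convergent_le_y0[OF assms(3)]
    by (intro LIMSEQ_le_const2) auto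
qed

text \<open>Shifting the index by $n$ amounts to replacing $t$ by $t + n$, so uniqueness of the entry at $0$
  for all parameters yields uniqueness of all the $y_n$. The other entries follow from
  $x_n = 1 - y_n$, $q_n = y_n t_n$ and $s_n = 1 - t_n$.\<close>

lemma UL_entries_unique:
  assumes ns: "factors_same_sign \<alpha> \<beta> t" and "0 < \<alpha>" and ul: "UL_entries \<alpha> \<beta> t y x s \<tau>"
  shows "y = UL_y \<alpha> \<beta> t" "x = UL_x \<alpha> \<beta> t" "s = UL_s \<alpha> \<beta> t" "\<tau> = UL_t \<alpha> \<beta> t"
proof -
  interpret given: UL_entries \<alpha> \<beta> t y x s \<tau> by (rule ul)
  interpret explicit: UL_entries \<alpha> \<beta> t "UL_y \<alpha> \<beta> t" "UL_x \<alpha> \<beta> t" "UL_s \<alpha> \<beta> t" "UL_t \<alpha> \<beta> t"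
    by (rule UL_entries_explicit[OF ns])
  show y: "y = UL_y \<alpha> \<beta> t"
  proof
    fix n
    have "y n = UL_y \<alpha> \<beta> (t + of_int n) 0"
      using UL_entries_y0_unique[OF factors_same_sign_shift[OF ns] \<open>0 < \<alpha>\<close> given.UL_entries_shift, of n] by simp
    then show "y n = UL_y \<alpha> \<beta> t n" by (simp add: UL_y_def algebra_simps)
  qed
  show "x = UL_x \<alpha> \<beta> t" by (simp add: fun_eq_iff given.x_eq explicit.x_eq y)
  show tau: "\<tau> = UL_t \<alpha> \<beta> t"
  proof
    fix n
    have "y n * \<tau> n = y n * UL_t \<alpha> \<beta> t n"
      by (metis given.q_eq explicit.q_eq y)
    then show "\<tau> n = UL_t \<alpha> \<beta> t n" using given.y_pos[of n] by simp
  qed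
  show "s = UL_s \<alpha> \<beta> t"
  proof
    fix n
    show "s n = UL_s \<alpha> \<beta> t n" using given.tau_eq[of n] explicit.tau_eq[of n] tau by simp
  qed
qed

theorem theorem4p1:
  fixes \<alpha> \<beta> t :: real
  assumes "admissible_pos \<alpha> \<beta> t"
  shows "cf_converges H_b (H_a \<alpha> \<beta> t) \<and> cf_converges H'_b (H'_a \<alpha> \<beta> t) \<and>
    cf_H \<alpha> \<beta> t = cf_H' \<alpha> \<beta> t \<and>
    cf_H' \<alpha> \<beta> t = (\<alpha> + t) / (\<alpha> + \<beta> + 2 * t + 1) \<and>
    (\<forall>y0. (\<exists>y x s \<tau>. stochastic_UL (P_mat \<alpha> \<beta> t) y x s \<tau> \<and> y 0 = y0)
          \<longleftrightarrow> y0 = cf_H \<alpha> \<beta> t) \<and>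
    (\<forall>y x s \<tau>. stochastic_UL (P_mat \<alpha> \<beta> t) y x s \<tau> \<longrightarrow>
      (\<forall>n::int.
         y n = (of_int n + t + \<alpha>) / (2 * of_int n + 2 * t + \<alpha> + \<beta> + 1) \<and>
         x n = (of_int n + t + \<beta> + 1) / (2 * of_int n + 2 * t + \<alpha> + \<beta> + 1) \<and>
         s n = (of_int n + t + \<alpha> + \<beta>) / (2 * of_int n + 2 * t + \<alpha> + \<beta>) \<and>
         \<tau> n = (of_int n + t) / (2 * of_int n + 2 * t + \<alpha> + \<beta>)))"
proof -
  have pos: "0 < \<alpha>" using assms by (simp add: admissible_pos_def)
  have ns: "factors_same_sign \<alpha> \<beta> t" by (rule admissible_pos_factors_same_sign[OF assms])
  note unique = UL_entries_unique[OF ns pos stochastic_UL_entries[OF ns]]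
  note cf = cf_converges_H[OF ns pos]
  have H_value: "UL_y \<alpha> \<beta> t 0 = (\<alpha> + t) / (\<alpha> + \<beta> + 2 * t + 1)"
    by (simp add: UL_y_def add_ac)
  show ?thesis
  proof (intro conjI allI impI)
    show "cf_converges H_b (H_a \<alpha> \<beta> t)" "cf_converges H'_b (H'_a \<alpha> \<beta> t)"
      by (rule cf)+
    show "cf_H \<alpha> \<beta> t = cf_H' \<alpha> \<beta> t" "cf_H' \<alpha> \<beta> t = (\<alpha> + t) / (\<alpha> + \<beta> + 2 * t + 1)"
      using cf H_value by simp_all
    show "(\<exists>y x s \<tau>. stochastic_UL (P_mat \<alpha> \<beta> t) y x s \<tau> \<and> y 0 = y0) \<longleftrightarrow> y0 = cf_H \<alpha> \<beta> t" for y0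
      using stochastic_UL_explicit[OF ns] unique(1) cf(3) by metis
  next
    fix y x s \<tau> n
    assume "stochastic_UL (P_mat \<alpha> \<beta> t) y x s \<tau>"
    note eqs = unique[OF this]
    show "y n = (of_int n + t + \<alpha>) / (2 * of_int n + 2 * t + \<alpha> + \<beta> + 1)"
      "x n = (of_int n + t + \<beta> + 1) / (2 * of_int n + 2 * t + \<alpha> + \<beta> + 1)"
      "s n = (of_int n + t + \<alpha> + \<beta>) / (2 * of_int n + 2 * t + \<alpha> + \<beta>)"
      "\<tau> n = (of_int n + t) / (2 * of_int n + 2 * t + \<alpha> + \<beta>)"
      unfolding eqs UL_y_def UL_x_def UL_s_def UL_t_def by (rule refl)+
  qed
qed

end
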